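(* Let $\psi:[0,\infty)\to\mathbb{R}$ be differentiable with $\psi'>0$, $\psi(0)=0$ and $\psi(x)\to\infty$ as $x\to\infty$, and let $\omega\in L^\infty(\mathbb{R}^+)$ be a nowhere zero differentiable weight function. Let $n\ge 1$ be an integer, and let $f:\mathbb{R}^+\to\mathbb{C}$ be a function such that $\mathcal{D}^k_{\psi,\omega}f$ exists on $\mathbb{R}^+$ for $k=1,\dots,n$. Assume $f\in L^1_{\omega,\psi}(\mathbb{R}^+)$ and $\mathcal{D}^n_{\psi,\omega}f\in L^1_{\omega,\psi}(\mathbb{R}^+)$. Let $p\in\mathbb{C}$ be such that the integrals defining $\mathcal{M}_{\psi,\omega}[\mathcal{D}^n_{\psi,\omega}f](p)$ and $\mathcal{M}_{\psi,\omega}[f](p-n)$ converge absolutely, and assume that for all $k=0,1,\dots,n-1$ $$\lim_{x\to0^+}\omega(x)(\psi(x))^{p-k-1}\,\mathcal{D}^{n-k-1}_{\psi,\omega}f(x)=0\quad\text{and}\quad\lim_{x\to\infty}\omega(x)(\psi(x))^{p-k-1}\,\mathcal{D}^{n-k-1}_{\psi,\omega}f(x)=0.$$ Then $$\mathcal{M}_{\psi,\omega}[\mathcal{D}^n_{\psi,\omega}f](p)=\frac{\Gamma(1-p+n)}{\Gamma(1-p)}\,\mathcal{M}_{\psi,\omega}[f](p-n).$$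
   Context: Here $\mathbb{R}^+=(0,\infty)$. The space $L^1_{\omega,\psi}(\mathbb{R}^+)$ consists of the measurable functions $f:\mathbb{R}^+\to\mathbb{C}$ with $\int_0^\infty|\omega(x)f(x)|\,\psi'(x)\,dx<\infty$. The generalized ($\psi$-$\omega$-) Mellin transform is $$\mathcal{M}_{\psi,\omega}[f](p)=\int_0^\infty(\psi(x))^{p-1}\omega(x)f(x)\psi'(x)\,dx,$$ for those $p\in\mathbb{C}$ for which the integral converges. The weighted derivative with respect to $\psi$ is $$\mathcal{D}_{\psi,\omega}f(x)=\frac{1}{\omega(x)\psi'(x)}\frac{d}{dx}\big(\omega(x)f(x)\big),$$ $\mathcal{D}^k_{\psi,\omega}$ is its $k$-fold iterate, and $\mathcal{D}^0_{\psi,\omega}f=f$. The ratio $\Gamma(1-p+n)/\Gamma(1-p)$ is understood as the polynomial $(1-p)(2-p)\cdots(n-p)$, which is its value away from the poles. *)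

theory Defs
  imports "HOL-Analysis.Analysis"
begin

text \<open>
  The half-line \<open>(0, \<infinity>)\<close> is the set \<open>{0<..}\<close>. Functions on it are total functions on the reals;
  nothing below depends on their values outside \<open>{0<..}\<close>. In particular \<^term>\<open>deriv \<psi> x\<close> is
  only used for \<open>x > 0\<close>, where it is the ordinary two-sided derivative.
\<close>

definition Linfty_pos :: "(real \<Rightarrow> complex) set" where
  "Linfty_pos =
     {g. g \<in> borel_measurable (lebesgue_on {0<..}) \<and>
         (\<exists>C::real. AE x in lebesgue_on {0<..}. norm (g x) \<le> C)}"

definition L1_weighted :: "(real \<Rightarrow> real) \<Rightarrow> (real \<Rightarrow> complex) \<Rightarrow> (real \<Rightarrow> complex) set" where
  "L1_weighted \<psi> \<omega> =
     {f. f \<in> borel_measurable (lebesgue_on {0<..}) \<and>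
         (\<integral>\<^sup>+x. ennreal (norm (\<omega> x * f x) * deriv \<psi> x) \<partial>lebesgue_on {0<..}) < \<infinity>}"

definition mellin_integrand ::
    "(real \<Rightarrow> real) \<Rightarrow> (real \<Rightarrow> complex) \<Rightarrow> (real \<Rightarrow> complex) \<Rightarrow> complex \<Rightarrow> real \<Rightarrow> complex" where
  "mellin_integrand \<psi> \<omega> f p x =
     of_real (\<psi> x) powr (p - 1) * \<omega> x * f x * of_real (deriv \<psi> x)"

text \<open>
  The Henstock-Kurzweil integral is used because it also covers conditionally convergent
  (improper) integrals; for absolutely convergent ones it is the Lebesgue integral.
\<close>

definition mellin ::
    "(real \<Rightarrow> real) \<Rightarrow> (real \<Rightarrow> complex) \<Rightarrow> (real \<Rightarrow> complex) \<Rightarrow> complex \<Rightarrow> complex" where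
  "mellin \<psi> \<omega> f p = integral {0<..} (mellin_integrand \<psi> \<omega> f p)"

definition weighted_deriv ::
    "(real \<Rightarrow> real) \<Rightarrow> (real \<Rightarrow> complex) \<Rightarrow> (real \<Rightarrow> complex) \<Rightarrow> real \<Rightarrow> complex" where
  "weighted_deriv \<psi> \<omega> f x =
     1 / (\<omega> x * of_real (deriv \<psi> x)) * vector_derivative (\<lambda>t. \<omega> t * f t) (at x)"

abbreviation weighted_deriv_iter ::
    "(real \<Rightarrow> real) \<Rightarrow> (real \<Rightarrow> complex) \<Rightarrow> nat \<Rightarrow> (real \<Rightarrow> complex) \<Rightarrow> real \<Rightarrow> complex" where
  "weighted_deriv_iter \<psi> \<omega> k \<equiv> weighted_deriv \<psi> \<omega> ^^ k"

text \<open>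
  \<^const>\<open>vector_derivative\<close> is a total function, so existence of the iterated derivatives up to
  order \<open>n\<close> on \<open>(0, \<infinity>)\<close> has to be stated separately: the derivative of order \<open>k + 1\<close> exists
  iff \<open>\<omega>\<close> times the one of order \<open>k\<close> is differentiable.
\<close>

definition weighted_derivs_exist ::
    "(real \<Rightarrow> real) \<Rightarrow> (real \<Rightarrow> complex) \<Rightarrow> nat \<Rightarrow> (real \<Rightarrow> complex) \<Rightarrow> bool" where
  "weighted_derivs_exist \<psi> \<omega> n f \<longleftrightarrow>
     (\<forall>k<n. \<forall>x>0. (\<lambda>t. \<omega> t * weighted_deriv_iter \<psi> \<omega> k f t) differentiable (at x))"

text \<open>The ratio \<open>\<Gamma>(1 - p + n) / \<Gamma>(1 - p)\<close>, continued polynomially through the poles.\<close>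

definition Gamma_ratio :: "complex \<Rightarrow> nat \<Rightarrow> complex" where
  "Gamma_ratio p n = (\<Prod>k=1..n. of_nat k - p)"

lemma Gamma_ratio_eq:
  assumes "1 - p \<notin> \<int>\<^sub>\<le>\<^sub>0"
  shows "Gamma_ratio p n = Gamma (1 - p + of_nat n) / Gamma (1 - p)"
proof -
  have "Gamma_ratio p n = pochhammer (1 - p) n"
    unfolding Gamma_ratio_def pochhammer_prod
    by (rule prod.reindex_bij_witness[where i = Suc and j = "\<lambda>k. k - 1"]) auto
  then show ?thesis
    using pochhammer_Gamma[OF assms] by simp
qed

end

theory Submission
  imports Defs
begin

text \<open>
  With \<open>I\<^sub>k = \<psi>\<^bsup>p-k-1\<^esup> \<omega> D\<^bsup>n-k\<^esup>f \<psi>'\<close> and the boundary term \<open>B\<^sub>k = \<omega> \<psi>\<^bsup>p-k-1\<^esup> D\<^bsup>n-k-1\<^esup>f\<close>, one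
  integration by parts is \<open>B\<^sub>k' = I\<^sub>k - (k + 1 - p) I\<^sub>k\<^sub>+\<^sub>1\<close>. Integrating these one at a time would
  need the convergence of the intermediate integrals, which is not assumed. Instead, with
  \<open>c\<^sub>k = (1 - p) \<dots> (k - p)\<close>, the sum \<open>\<Sum>k<n. c\<^sub>k B\<^sub>k\<close> has the telescoping derivative
  \<open>I\<^sub>0 - c\<^sub>n I\<^sub>n\<close>, which is absolutely integrable by hypothesis, so the fundamental theorem of
  calculus is needed only once.
\<close>

text \<open>The fundamental theorem of calculus applies on each compact interval
  \<open>{l m..u m}\<close>, and these exhaust the half-line. Dominated convergence with majorant
  \<open>norm (h x)\<close> then passes to the limit, so \<open>F\<close> needs limits at both ends
  but no value at 0.\<close>

lemma integral_Ioi_eq_limits: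
  fixes F h :: "real \<Rightarrow> 'a::euclidean_space"
  assumes int: "h absolutely_integrable_on {0<..}"
    and deriv: "\<And>x. x > 0 \<Longrightarrow> (F has_vector_derivative h x) (at x)"
    and lim0: "(F \<longlongrightarrow> a) (at_right 0)" and lim_top: "(F \<longlongrightarrow> b) at_top"
  shows "integral {0<..} h = b - a"
proof -
  define l u where "l m = 1 / real (Suc m)" and "u m = real (Suc m)" for m
  define g where "g m x = (if x \<in> {l m..u m} then h x else 0)" for m x
  have l_pos: "l m > 0" and lu: "l m \<le> u m" for m
    by (simp_all add: l_def u_def field_simps)
  have sub: "{l m..u m} \<subseteq> {0<..}" for m
    using l_pos[of m] by auto
  have FTC: "(h has_integral (F (u m) - F (l m))) {l m..u m}" for m
  proof (rule fundamental_theorem_of_calculus[OF lu])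
    fix x assume "x \<in> {l m..u m}"
    then show "(F has_vector_derivative h x) (at x within {l m..u m})"
      using l_pos[of m] by (intro has_vector_derivative_at_within[OF deriv]) auto
  qed
  have g_int: "(g m has_integral (F (u m) - F (l m))) {0<..}" for m
    unfolding g_def using FTC has_integral_restrict[OF sub] by blast
  have l_lim: "filterlim l (at_right 0) sequentially"
    unfolding l_def filterlim_at
    using LIMSEQ_inverse_real_of_nat[unfolded inverse_eq_divide] by (auto simp del: of_nat_Suc)
  have u_lim: "filterlim u at_top sequentially"
    unfolding u_def by (intro filterlim_compose[OF filterlim_real_sequentially] filterlim_Suc)
  have "(\<lambda>m. integral {0<..} (g m)) \<longlonglongrightarrow> integral {0<..} h"
  proof (rule dominated_convergence(2)[where h = "\<lambda>x. norm (h x)"])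
    show "g m integrable_on {0<..}" for m
      using g_int by blast
    show "(\<lambda>x. norm (h x)) integrable_on {0<..}"
      using int by (simp add: absolutely_integrable_on_def)
    show "norm (g m x) \<le> norm (h x)" for m x
      by (simp add: g_def)
    fix x :: real assume "x \<in> {0<..}"
    then have "\<forall>\<^sub>F m in sequentially. l m < x"
      using l_lim by (auto simp: filterlim_at intro: order_tendstoD)
    moreover have "\<forall>\<^sub>F m in sequentially. x \<le> u m"
      using u_lim by (simp add: filterlim_at_top)
    ultimately have "\<forall>\<^sub>F m in sequentially. h x = g m x"
      by eventually_elim (simp add: g_def)
    then show "(\<lambda>m. g m x) \<longlonglongrightarrow> h x"
      by (rule Lim_transform_eventually[OF tendsto_const])
  qed
  moreover have "(\<lambda>m. integral {0<..} (g m)) \<longlonglongrightarrow> b - a"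
    unfolding integral_unique[OF g_int]
    by (intro tendsto_diff filterlim_compose[OF lim_top u_lim] filterlim_compose[OF lim0 l_lim])
  ultimately show ?thesis
    by (rule LIMSEQ_unique)
qed

lemma Gamma_ratio_0: "Gamma_ratio p 0 = 1"
  by (simp add: Gamma_ratio_def)

lemma Gamma_ratio_Suc: "Gamma_ratio p (Suc k) = (of_nat k + 1 - p) * Gamma_ratio p k"
  by (simp add: Gamma_ratio_def algebra_simps)

text \<open>Chain rule; positivity of \<open>\<psi> x\<close> keeps the base off the branch cut of
  the complex power.\<close>

lemma has_vector_derivative_of_real_powr:
  fixes q :: complex
  assumes "(\<psi> has_real_derivative d) (at x)" and "\<psi> x > 0"
  shows "((\<lambda>t. of_real (\<psi> t) powr q) has_vector_derivative
           q * of_real (\<psi> x) powr (q - 1) * of_real d) (at x)"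
proof -
  have inner: "((\<lambda>t. complex_of_real (\<psi> t)) has_vector_derivative of_real d) (at x)"
    using assms(1) by (simp add: has_vector_derivative_of_real has_real_derivative_iff_has_vector_derivative)
  have outer: "((\<lambda>z. z powr q) has_field_derivative q * of_real (\<psi> x) powr (q - 1)) (at (of_real (\<psi> x)))"
    using assms(2) by (intro has_field_derivative_powr) (auto simp: complex_nonpos_Reals_iff)
  show ?thesis
    using field_vector_diff_chain_at[OF inner outer] by (simp add: o_def mult_ac)
qed

theorem mainTheorem3:
  fixes \<psi> :: "real \<Rightarrow> real" and \<omega> f :: "real \<Rightarrow> complex" and n :: nat and p :: complex
  assumes psi_deriv: "\<forall>x\<ge>0. \<exists>d>0. (\<psi> has_real_derivative d) (at x within {0..})"
    and psi_zero: "\<psi> 0 = 0"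
    and psi_top: "filterlim \<psi> at_top at_top"
    and omega_Linfty: "\<omega> \<in> Linfty_pos"
    and omega_nonzero: "\<forall>x>0. \<omega> x \<noteq> 0"
    and omega_diff: "\<forall>x>0. \<omega> differentiable (at x)"
    and n_pos: "n \<ge> 1"
    and derivs_exist: "weighted_derivs_exist \<psi> \<omega> n f"
    and f_L1: "f \<in> L1_weighted \<psi> \<omega>"
    and Dn_L1: "weighted_deriv_iter \<psi> \<omega> n f \<in> L1_weighted \<psi> \<omega>"
    and mellin_Dn_conv:
      "mellin_integrand \<psi> \<omega> (weighted_deriv_iter \<psi> \<omega> n f) p absolutely_integrable_on {0<..}"
    and mellin_f_conv:
      "mellin_integrand \<psi> \<omega> f (p - of_nat n) absolutely_integrable_on {0<..}"
    and lim_zero: "\<forall>k<n.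
      ((\<lambda>x. \<omega> x * of_real (\<psi> x) powr (p - of_nat k - 1) *
            weighted_deriv_iter \<psi> \<omega> (n - k - 1) f x) \<longlongrightarrow> 0) (at_right 0)"
    and lim_top: "\<forall>k<n.
      ((\<lambda>x. \<omega> x * of_real (\<psi> x) powr (p - of_nat k - 1) *
            weighted_deriv_iter \<psi> \<omega> (n - k - 1) f x) \<longlongrightarrow> 0) at_top"
  shows "mellin \<psi> \<omega> (weighted_deriv_iter \<psi> \<omega> n f) p
           = Gamma_ratio p n * mellin \<psi> \<omega> f (p - of_nat n)"
proof -
  let ?D = "\<lambda>k. weighted_deriv_iter \<psi> \<omega> k f"
  define B where "B k x = \<omega> x * of_real (\<psi> x) powr (p - of_nat k - 1) * ?D (n - k - 1) x" for k x
  define I where "I k = mellin_integrand \<psi> \<omega> (?D (n - k)) (p - of_nat k)" for k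
  have psi_has_deriv: "(\<psi> has_real_derivative deriv \<psi> x) (at x)" and deriv_pos: "deriv \<psi> x > 0"
    if x: "x > 0" for x
  proof -
    obtain d where "d > 0" and "(\<psi> has_real_derivative d) (at x within {0..})"
      using psi_deriv less_imp_le[OF x] by blast
    \<comment> \<open>The one-sided derivative at 0 is irrelevant here: a point \<open>x > 0\<close>
      is interior to \<open>{0..}\<close>.\<close>
    moreover have "at x within {0..} = at x"
      using x by (intro at_within_interior) simp
    ultimately have d: "(\<psi> has_real_derivative d) (at x)"
      by simp
    then have "deriv \<psi> x = d"
      by (rule DERIV_imp_deriv)
    with d \<open>d > 0\<close> show "(\<psi> has_real_derivative deriv \<psi> x) (at x)" "deriv \<psi> x > 0"
      by simp_all
  qed
  have psi_pos: "\<psi> x > 0" if "x > 0" for x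
  proof -
    \<comment> \<open>Continuity up to 0 lets strict monotonicity start from
      \<open>\<psi> 0 = 0\<close>, with derivatives taken only at interior points.\<close>
    have "continuous_on {0..} \<psi>"
      unfolding continuous_on_eq_continuous_within using psi_deriv DERIV_continuous
      by (metis atLeast_iff)
    then have "continuous_on {0..x} \<psi>"
      by (rule continuous_on_subset) simp
    then have "\<psi> 0 < \<psi> x"
      using psi_has_deriv deriv_pos by (intro DERIV_pos_imp_increasing_open[OF that]) blast+
    then show ?thesis
      using psi_zero by simp
  qed
  have D_deriv: "((\<lambda>t. \<omega> t * ?D k t) has_vector_derivative \<omega> x * ?D (Suc k) x * of_real (deriv \<psi> x)) (at x)"
    if "k < n" "x > 0" for k x
  proof -
    have "(\<lambda>t. \<omega> t * ?D k t) differentiable (at x)"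
      using derivs_exist that by (simp add: weighted_derivs_exist_def)
    moreover have "\<omega> x * ?D (Suc k) x * of_real (deriv \<psi> x) = vector_derivative (\<lambda>t. \<omega> t * ?D k t) (at x)"
      using omega_nonzero deriv_pos[OF that(2)] that(2) by (simp add: weighted_deriv_def)
    ultimately show ?thesis
      by (simp add: vector_derivative_works)
  qed
  have B_deriv: "(B k has_vector_derivative I k x - (of_nat k + 1 - p) * I (Suc k) x) (at x)"
    if "k < n" "x > 0" for k x
  proof -
    \<comment> \<open>Aligns the truncated subtractions: differentiating the factor with
      \<open>?D (n - k - 1)\<close> yields \<open>?D (n - k)\<close>, hence \<open>I k\<close>,
      while differentiating the power leaves \<open>?D (n - Suc k)\<close> and lowers the exponent
      by one, hence \<open>I (Suc k)\<close>.\<close>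
    have "n - k = Suc (n - Suc k)"
      using that by simp
    then show ?thesis
      using has_vector_derivative_mult[OF
        has_vector_derivative_of_real_powr[OF psi_has_deriv[OF that(2)] psi_pos[OF that(2)], of "p - of_nat k - 1"]
        D_deriv[of "n - k - 1", OF _ that(2)]] that
      by (simp add: B_def[abs_def] I_def mellin_integrand_def algebra_simps)
  qed
  define S where "S x = (\<Sum>k<n. Gamma_ratio p k * B k x)" for x
  have S_deriv: "(S has_vector_derivative I 0 x - Gamma_ratio p n * I n x) (at x)" if "x > 0" for x
  proof -
    have "(S has_vector_derivative
        (\<Sum>k<n. Gamma_ratio p k * (I k x - (of_nat k + 1 - p) * I (Suc k) x))) (at x)"
      unfolding S_def using B_deriv that
      by (intro has_vector_derivative_sum has_vector_derivative_mult_right) auto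
    also have "(\<Sum>k<n. Gamma_ratio p k * (I k x - (of_nat k + 1 - p) * I (Suc k) x)) =
        (\<Sum>k<n. Gamma_ratio p k * I k x - Gamma_ratio p (Suc k) * I (Suc k) x)"
      by (simp add: Gamma_ratio_Suc algebra_simps)
    also have "\<dots> = I 0 x - Gamma_ratio p n * I n x"
      by (subst sum_lessThan_telescope') (simp add: Gamma_ratio_0)
    finally show ?thesis .
  qed
  \<comment> \<open>Stated for an arbitrary filter to serve both ends of the half-line.\<close>
  have S_lim: "(S \<longlongrightarrow> 0) F" if "\<And>k. k < n \<Longrightarrow> (B k \<longlongrightarrow> 0) F" for F
    unfolding S_def using that by (intro tendsto_null_sum tendsto_mult_right_zero) auto
  \<comment> \<open>\<open>I 0\<close> and \<open>I n\<close> are exactly the integrands of the two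
    Mellin transforms in the claim, since \<open>n - n = 0\<close> turns \<open>?D (n - n)\<close>
    into \<open>f\<close>.\<close>
  have int0: "I 0 absolutely_integrable_on {0<..}" and intn: "I n absolutely_integrable_on {0<..}"
    using mellin_Dn_conv mellin_f_conv by (simp_all add: I_def)
  have intn': "(\<lambda>x. Gamma_ratio p n * I n x) absolutely_integrable_on {0<..}"
    using intn by (rule set_integrable_mult_right)
  have "integral {0<..} (\<lambda>x. I 0 x - Gamma_ratio p n * I n x) = 0 - 0"
  proof (rule integral_Ioi_eq_limits[OF _ S_deriv])
    show "(\<lambda>x. I 0 x - Gamma_ratio p n * I n x) absolutely_integrable_on {0<..}"
      using int0 intn' by (rule set_integral_diff(1))
    show "(S \<longlongrightarrow> 0) (at_right 0)" "(S \<longlongrightarrow> 0) at_top"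
      using lim_zero lim_top by (auto intro!: S_lim simp: B_def[abs_def])
  qed
  then have "integral {0<..} (I 0) = Gamma_ratio p n * integral {0<..} (I n)"
    using int0 intn'
    by (simp add: integral_diff set_lebesgue_integral_eq_integral(1))
  then show ?thesis
    by (simp add: mellin_def I_def)
qed

end
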